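(* Let $\Theta=(\Sigma,\mathit{sim},\mathit{ser})$ be a comtrace alphabet with $\mathit{sim}\setminus\mathit{ser}=\emptyset$ (a radical comtrace alphabet), let $\tau$ be a comtrace over $\Theta$ and let $\sigma$ be the step trace over the concurrent alphabet $(\Sigma,\mathit{ind})$ containing some (equivalently every) step sequence of $\tau$. Then $(\Sigma\times\Sigma)\setminus\mathit{ind}=\mathit{dep}$ and $\Pi^\perp_\tau=\Pi_\sigma$, i.e. $\Pi^\perp_{a,b}(\tau)=\Pi_{a,b}(\sigma)$ for every $(a,b)\in\mathit{dep}$.
   Context: A comtrace alphabet is $\Theta=(\Sigma,\mathit{sim},\mathit{ser})$ with $\Sigma$ finite nonempty, $\mathit{ser}\subseteq\mathit{sim}\subseteq\Sigma\times\Sigma$, $\mathit{sim}$ irreflexive and symmetric; steps are nonempty $A\subseteq\Sigma$ with $(a,b)\in\mathit{sim}$ for distinct $a,b\in A$; comtraces are classes of the reflexive, symmetric, transitive closure of $uABz\sim u(A\cup B)z$ for steps with $A\times B\subseteq\mathit{ser}$. $\mathit{dep}=(\Sigma\times\Sigma)\setminus\mathit{sim}$, $\mathit{ind}=\mathit{ser}\cap\mathit{ser}^{-1}$, $\mathit{ssm}=\mathit{sim}\setminus(\mathit{ser}\cup\mathit{ser}^{-1})$, $\mathit{wdp}=\mathit{ser}^{-1}\setminus\mathit{ser}$. Comtrace projections (fresh symbol $\perp$): for $(a,b)\notin\mathit{ind}$ and step $A$, $\Pi^\perp_{a,b}(A)=\epsilon$ if $\{a,b\}\cap A=\emptyset$;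 $a$ if $a\in A,b\notin A$; $b$ if $b\in A,a\notin A$; $a$ if $a=b\in A$; for distinct $a,b\in A$: $ba$ if $(a,b)\in\mathit{wdp}$, $ab$ if $(b,a)\in\mathit{wdp}$, $\perp$ if $(a,b)\in\mathit{ssm}$; concatenated over steps, and $\Pi^\perp_\tau(a,b)=\Pi^\perp_{a,b}(w)$ for $w\in\tau$. Step traces over a concurrent alphabet $(\Sigma,I)$ ($I$ irreflexive symmetric): steps are nonempty sets of pairwise $I$-related actions, and step traces are classes of the reflexive, symmetric, transitive closure of $uABz\sim u(A\cup B)z$ for $A\times B\subseteq I$. For $(a,b)$ not in $I$ (possibly $a=b$), $\Pi_{a,b}$ maps a step sequence to a word: $\Pi_{a,b}(Aw)=a\Pi_{a,b}(w)$ if $a\in A$, $b\Pi_{a,b}(w)$ if $b\in A$, $\Pi_{a,b}(w)$ otherwise, and $\Pi_{a,b}(\text{empty})=\epsilon$; $\Pi_\sigma(a,b)=\Pi_{a,b}(w)$ for $w\in\sigma$. *)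

theory Defs
  imports Main
begin

definition comtrace_alphabet :: "'a set \<Rightarrow> ('a \<times> 'a) set \<Rightarrow> ('a \<times> 'a) set \<Rightarrow> bool" where
  "comtrace_alphabet \<Sigma> sim ser \<longleftrightarrow>
     finite \<Sigma> \<and> \<Sigma> \<noteq> {} \<and> ser \<subseteq> sim \<and> sim \<subseteq> \<Sigma> \<times> \<Sigma> \<and> irrefl sim \<and> sym sim"

definition dep :: "'a set \<Rightarrow> ('a \<times> 'a) set \<Rightarrow> ('a \<times> 'a) set" where
  "dep \<Sigma> sim = (\<Sigma> \<times> \<Sigma>) - sim"

definition ind :: "('a \<times> 'a) set \<Rightarrow> ('a \<times> 'a) set" where
  "ind ser = ser \<inter> ser\<inverse>"

definition ssm :: "('a \<times> 'a) set \<Rightarrow> ('a \<times> 'a) set \<Rightarrow> ('a \<times> 'a) set" where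
  "ssm sim ser = sim - (ser \<union> ser\<inverse>)"

definition wdp :: "('a \<times> 'a) set \<Rightarrow> ('a \<times> 'a) set" where
  "wdp ser = ser\<inverse> - ser"

definition steps :: "'a set \<Rightarrow> ('a \<times> 'a) set \<Rightarrow> 'a set set" where
  "steps \<Sigma> R = {A. A \<noteq> {} \<and> A \<subseteq> \<Sigma> \<and> (\<forall>a\<in>A. \<forall>b\<in>A. a \<noteq> b \<longrightarrow> (a, b) \<in> R)}"

text \<open>The generating relation shared by comtraces and step traces: \<open>R\<close> determines which sets
  are steps, and \<open>Q\<close> which steps may be split. Comtraces take \<open>R = sim\<close> and \<open>Q = ser\<close>; step traces
  over \<open>(\<Sigma>, I)\<close> take \<open>R = Q = I\<close>.\<close>

inductive step_split ::
  "'a set \<Rightarrow> ('a \<times> 'a) set \<Rightarrow> ('a \<times> 'a) set \<Rightarrow> 'a set list \<Rightarrow> 'a set list \<Rightarrow> bool"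
  for \<Sigma> R Q where
  "\<lbrakk>u \<in> lists (steps \<Sigma> R); z \<in> lists (steps \<Sigma> R); A \<in> steps \<Sigma> R; B \<in> steps \<Sigma> R; A \<times> B \<subseteq> Q\<rbrakk>
     \<Longrightarrow> step_split \<Sigma> R Q (u @ [A, B] @ z) (u @ [A \<union> B] @ z)"

definition step_equiv ::
  "'a set \<Rightarrow> ('a \<times> 'a) set \<Rightarrow> ('a \<times> 'a) set \<Rightarrow> ('a set list \<times> 'a set list) set" where
  "step_equiv \<Sigma> R Q = {(v, w). v \<in> lists (steps \<Sigma> R) \<and> w \<in> lists (steps \<Sigma> R) \<and>
                               equivclp (step_split \<Sigma> R Q) v w}"

definition comtraces ::
  "'a set \<Rightarrow> ('a \<times> 'a) set \<Rightarrow> ('a \<times> 'a) set \<Rightarrow> 'a set list set set" where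
  "comtraces \<Sigma> sim ser = lists (steps \<Sigma> sim) // step_equiv \<Sigma> sim ser"

definition step_traces :: "'a set \<Rightarrow> ('a \<times> 'a) set \<Rightarrow> 'a set list set set" where
  "step_traces \<Sigma> I = lists (steps \<Sigma> I) // step_equiv \<Sigma> I I"

text \<open>Words over the alphabet extended by the fresh symbol \<open>\<bottom>\<close> are modelled as \<open>'a option list\<close>,
  with \<open>None\<close> for \<open>\<bottom>\<close>. The final \<open>undefined\<close> is never reached when \<open>A\<close> is a step and
  \<open>(a, b) \<notin> ind ser\<close>.\<close>

definition comtrace_proj_step ::
  "('a \<times> 'a) set \<Rightarrow> ('a \<times> 'a) set \<Rightarrow> 'a \<Rightarrow> 'a \<Rightarrow> 'a set \<Rightarrow> 'a option list" where
  "comtrace_proj_step sim ser a b A =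
     (if a \<notin> A \<and> b \<notin> A then []
      else if a \<in> A \<and> b \<notin> A then [Some a]
      else if b \<in> A \<and> a \<notin> A then [Some b]
      else if a = b then [Some a]
      else if (a, b) \<in> wdp ser then [Some b, Some a]
      else if (b, a) \<in> wdp ser then [Some a, Some b]
      else if (a, b) \<in> ssm sim ser then [None]
      else undefined)"

definition comtrace_proj_seq ::
  "('a \<times> 'a) set \<Rightarrow> ('a \<times> 'a) set \<Rightarrow> 'a \<Rightarrow> 'a \<Rightarrow> 'a set list \<Rightarrow> 'a option list" where
  "comtrace_proj_seq sim ser a b w = concat (map (comtrace_proj_step sim ser a b) w)"

primrec step_proj_seq :: "'a \<Rightarrow> 'a \<Rightarrow> 'a set list \<Rightarrow> 'a list" where
  "step_proj_seq a b [] = []"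
| "step_proj_seq a b (A # w) =
     (if a \<in> A then a # step_proj_seq a b w
      else if b \<in> A then b # step_proj_seq a b w
      else step_proj_seq a b w)"

text \<open>The projection of a class is the common value of the projection on its members; with
  \<open>the_elem\<close> it is only meaningful when that value is unique.\<close>

definition comtrace_proj ::
  "('a \<times> 'a) set \<Rightarrow> ('a \<times> 'a) set \<Rightarrow> 'a set list set \<Rightarrow> 'a \<Rightarrow> 'a \<Rightarrow> 'a option list" where
  "comtrace_proj sim ser \<tau> a b = the_elem (comtrace_proj_seq sim ser a b ` \<tau>)"

definition step_trace_proj :: "'a set list set \<Rightarrow> 'a \<Rightarrow> 'a \<Rightarrow> 'a list" where
  "step_trace_proj \<sigma> a b = the_elem (step_proj_seq a b ` \<sigma>)"

end

theory Submission
  imports Defs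
begin

text \<open>If \<open>sim \<subseteq> ser\<close>, then \<open>sim = ser\<close> is symmetric, so \<open>ind = ser = sim\<close> and comtraces are literally
  step traces over \<open>(\<Sigma>, ind)\<close>. Two dependent actions never occur together in a step, so both
  projections agree on every step sequence; the projection to a dependent pair is unchanged by
  splitting \<open>A \<union> B\<close> into \<open>A, B\<close> with \<open>A \<times> B \<subseteq> ser\<close>, because at most one of \<open>A\<close> and \<open>B\<close> meets the pair.\<close>

lemma equiv_step_equiv: "equiv (lists (steps \<Sigma> R)) (step_equiv \<Sigma> R Q)"
proof (rule equivI)
  show "step_equiv \<Sigma> R Q \<subseteq> lists (steps \<Sigma> R) \<times> lists (steps \<Sigma> R)"
    by (auto simp: step_equiv_def)
  show "refl_on (lists (steps \<Sigma> R)) (step_equiv \<Sigma> R Q)"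
    by (auto simp: refl_on_def step_equiv_def)
  show "sym (step_equiv \<Sigma> R Q)"
    by (auto simp: sym_def step_equiv_def intro: equivclp_sym)
  show "trans (step_equiv \<Sigma> R Q)"
    by (auto simp: trans_def step_equiv_def intro: equivclp_trans)
qed

lemma step_proj_seq_append:
  "step_proj_seq a b (u @ v) = step_proj_seq a b u @ step_proj_seq a b v"
  by (induction u) auto

lemma step_proj_seq_step_split:
  assumes "step_split \<Sigma> R Q v w" "({a, b} \<times> {a, b}) \<inter> Q = {}"
  shows "step_proj_seq a b v = step_proj_seq a b w"
  using assms(1)
proof cases
  case (1 u z A B)
  \<comment> \<open>Otherwise some x in \<open>A\<close> and y in \<open>B\<close>, both from
    \<open>{a, b}\<close>, would give (x, y) in \<open>Q\<close>. The diagonal pairs matter too: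
    they stop one letter from lying in both \<open>A\<close> and \<open>B\<close>, where merging
    would lose an occurrence.\<close>
  have "(a \<notin> A \<and> b \<notin> A) \<or> (a \<notin> B \<and> b \<notin> B)"
    using \<open>A \<times> B \<subseteq> Q\<close> assms(2) by blast
  then have "step_proj_seq a b ([A, B] @ z) = step_proj_seq a b ([A \<union> B] @ z)"
    by (elim disjE) simp_all
  then show ?thesis
    by (simp only: 1 step_proj_seq_append)
qed

lemma step_proj_seq_step_equiv:
  assumes "(v, w) \<in> step_equiv \<Sigma> R Q" "({a, b} \<times> {a, b}) \<inter> Q = {}"
  shows "step_proj_seq a b v = step_proj_seq a b w"
proof -
  have "equivclp (step_split \<Sigma> R Q) v w"
    using assms(1) by (simp add: step_equiv_def)
  then show ?thesis
  proof (induction rule: equivclp_induct)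
    case (step x y)
    then show ?case
      using step_proj_seq_step_split[OF _ assms(2)] by metis
  qed simp
qed

text \<open>A step holding both letters forces \<open>a = b\<close>, so the branches for
  \<open>wdp\<close>, \<open>ssm\<close> and \<open>undefined\<close> are never reached and each
  step contributes at most one letter.\<close>

lemma comtrace_proj_seq_eq_step_proj_seq:
  assumes "w \<in> lists (steps \<Sigma> sim)" "(a, b) \<notin> sim"
  shows "comtrace_proj_seq sim ser a b w = map Some (step_proj_seq a b w)"
  using assms(1)
proof induction
  case (Cons A w)
  then have "a = b" if "a \<in> A" "b \<in> A"
    using assms(2) that by (auto simp: steps_def)
  with Cons.IH show ?case
    by (auto simp: comtrace_proj_seq_def comtrace_proj_step_def)
qed (simp add: comtrace_proj_seq_def)

text \<open>Allows a class projection to be evaluated at any chosen member once it is constant on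
  the class.\<close>

lemma the_elem_image_const:
  assumes "x \<in> S" "\<And>y. y \<in> S \<Longrightarrow> f y = f x"
  shows "the_elem (f ` S) = f x"
  using assms by (intro the_elem_image_unique) blast+

lemma comtrace_proj_eq_step_trace_proj:
  assumes "irrefl sim" "sym sim" "\<tau> \<in> step_traces \<Sigma> sim" "(a, b) \<notin> sim"
  shows "comtrace_proj sim ser \<tau> a b = map Some (step_trace_proj \<tau> a b)"
proof -
  \<comment> \<open>Symmetry excludes \<open>(b, a)\<close>, irreflexivity the two diagonal
    pairs.\<close>
  have dep: "({a, b} \<times> {a, b}) \<inter> sim = {}"
    using assms(1,2,4) by (auto simp: irrefl_def dest: symD)
  note quotient = equiv_step_equiv assms(3)[unfolded step_traces_def]
  obtain w where w: "w \<in> \<tau>"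
    using in_quotient_imp_non_empty[OF quotient] by blast
  have same: "step_proj_seq a b v = step_proj_seq a b w" if "v \<in> \<tau>" for v
    using quotient_eq_iff[OF equiv_step_equiv quotient(2) quotient(2) that w] dep
    by (auto intro: step_proj_seq_step_equiv)
  have seq: "comtrace_proj_seq sim ser a b v = map Some (step_proj_seq a b v)" if "v \<in> \<tau>" for v
    using in_quotient_imp_subset[OF quotient] that assms(4)
    by (blast intro: comtrace_proj_seq_eq_step_proj_seq)
  have "step_trace_proj \<tau> a b = step_proj_seq a b w"
    unfolding step_trace_proj_def using w same by (rule the_elem_image_const)
  \<comment> \<open>Constancy of the comtrace projection on the class is inherited from the step
    projection through \<open>seq\<close>.\<close>
  moreover have "comtrace_proj sim ser \<tau> a b = comtrace_proj_seq sim ser a b w"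
    unfolding comtrace_proj_def using w by (rule the_elem_image_const) (metis seq same w)
  ultimately show ?thesis
    using seq[OF w] by simp
qed

theorem theorem4p13:
  fixes \<Sigma> :: "'a set" and sim ser :: "('a \<times> 'a) set" and \<tau> :: "'a set list set"
  assumes "comtrace_alphabet \<Sigma> sim ser"
    and "sim - ser = {}"
    and "\<tau> \<in> comtraces \<Sigma> sim ser"
  shows "(\<Sigma> \<times> \<Sigma>) - ind ser = dep \<Sigma> sim \<and>
    (\<exists>!\<sigma>. \<sigma> \<in> step_traces \<Sigma> (ind ser) \<and> (\<exists>w\<in>\<tau>. w \<in> \<sigma>)) \<and>
    (\<forall>\<sigma>\<in>step_traces \<Sigma> (ind ser).
       ((\<exists>w\<in>\<tau>. w \<in> \<sigma>) \<longleftrightarrow> (\<forall>w\<in>\<tau>. w \<in> \<sigma>)) \<and>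
       ((\<exists>w\<in>\<tau>. w \<in> \<sigma>) \<longrightarrow>
          (\<forall>(a, b)\<in>dep \<Sigma> sim.
             comtrace_proj sim ser \<tau> a b = map Some (step_trace_proj \<sigma> a b))))"
proof -
  have sim: "irrefl sim" "sym sim" and ser: "ser = sim"
    using assms(1,2) by (auto simp: comtrace_alphabet_def)
  have ind: "ind ser = sim"
    using sim(2) by (simp add: ind_def ser sym_conv_converse_eq)
  \<comment> \<open>With \<open>ser = sim\<close> both quotients unfold to the same set.\<close>
  have \<tau>: "\<tau> \<in> step_traces \<Sigma> sim"
    using assms(3) by (simp add: comtraces_def step_traces_def ser)
  then have ne: "\<exists>w. w \<in> \<tau>"
    using in_quotient_imp_non_empty[OF equiv_step_equiv] unfolding step_traces_def by blast
  \<comment> \<open>Classes of one equivalence are equal or disjoint, and \<tau> is nonempty. Hence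
    \<tau> itself is the unique witness \<sigma>, and meeting it amounts to containing it.\<close>
  have meets_iff: "(\<exists>w\<in>\<tau>. w \<in> \<sigma>) \<longleftrightarrow> \<sigma> = \<tau>" if "\<sigma> \<in> step_traces \<Sigma> sim" for \<sigma>
    using quotient_disj[OF equiv_step_equiv that[unfolded step_traces_def] \<tau>[unfolded step_traces_def]] ne
    by blast
  have proj: "comtrace_proj sim ser \<tau> a b = map Some (step_trace_proj \<tau> a b)"
    if "(a, b) \<in> dep \<Sigma> sim" for a b
    using comtrace_proj_eq_step_trace_proj[OF sim \<tau>] that by (simp add: dep_def)
  show ?thesis
    unfolding ind
  proof (intro conjI ballI impI)
    show "\<Sigma> \<times> \<Sigma> - sim = dep \<Sigma> sim"
      by (simp add: dep_def)
    show "\<exists>!\<sigma>. \<sigma> \<in> step_traces \<Sigma> sim \<and> (\<exists>w\<in>\<tau>. w \<in> \<sigma>)"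
      using meets_iff \<tau> by blast
  next
    fix \<sigma> assume \<sigma>: "\<sigma> \<in> step_traces \<Sigma> sim"
    show "(\<exists>w\<in>\<tau>. w \<in> \<sigma>) \<longleftrightarrow> (\<forall>w\<in>\<tau>. w \<in> \<sigma>)"
      using meets_iff[OF \<sigma>] ne by blast
  next
    fix \<sigma> p assume "\<sigma> \<in> step_traces \<Sigma> sim" "\<exists>w\<in>\<tau>. w \<in> \<sigma>" and p: "p \<in> dep \<Sigma> sim"
    then have "\<sigma> = \<tau>"
      using meets_iff by simp
    with proj p show "case p of (a, b) \<Rightarrow> comtrace_proj sim ser \<tau> a b = map Some (step_trace_proj \<sigma> a b)"
      by (cases p) simp
  qed
qed

end
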